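(* Let $\mathcal{A}$ be a finite dimensional $\mathbb{Q}$-algebra with the hyperbolic property and let $J=J(\mathcal{A})$ be its Jacobson radical. Then $J^2=0$ and $\dim_{\mathbb{Q}}(J)\leq 1$. Furthermore, if $J\neq 0$, there exists $j_0\in\mathcal{A}$ such that $j_0^2=0$, $J=\langle j_0\rangle_{\mathbb{Q}}$ (the $\mathbb{Q}$-span of $j_0$), and $1+J\cong\mathbb{Q}$, where $1+J$ is regarded as a multiplicative group and $\mathbb{Q}$ as an additive group.
   Context: All $\mathbb{Q}$-algebras are associative with identity. A $\mathbb{Z}$-order of a finite dimensional $\mathbb{Q}$-algebra $\mathcal{A}$ is a unital subring $\Gamma\subset\mathcal{A}$, finitely generated as a $\mathbb{Z}$-module, with $\mathbb{Q}\Gamma=\mathcal{A}$. $\mathcal{A}$ has the hyperbolic property if $\mathbb{Z}^2$ does not embed in the unit group $\mathcal{U}(\Gamma)$ for a $\mathbb{Z}$-order $\Gamma$ of $\mathcal{A}$ (independent of the order). *)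

theory Defs
  imports Complex_Main "HOL-Algebra.Elementary_Groups"
begin

(* The sort {ring, monoid_mult} is used instead of ring_1, since the latter imposes 0 \<noteq> 1 and
   would exclude the zero algebra. *)

locale rat_algebra = vector_space scale
  for scale :: "rat \<Rightarrow> 'a::{ring, monoid_mult} \<Rightarrow> 'a" +
  assumes scale_mult_left: "scale q x * y = scale q (x * y)"
    and scale_mult_right: "x * scale q y = scale q (x * y)"

sublocale rat_algebra \<subseteq> int: module "\<lambda>n::int. scale (of_int n)"
  by unfold_locales (simp_all add: scale_right_distrib scale_left_distrib)

locale fin_dim_rat_algebra = rat_algebra +
  assumes finite_dimensional: "\<exists>B. finite B \<and> span B = UNIV"

definition left_ideal :: "'a::{ring, monoid_mult} set \<Rightarrow> bool" where
  "left_ideal I \<longleftrightarrow> 0 \<in> I \<and> (\<forall>x\<in>I. \<forall>y\<in>I. x - y \<in> I) \<and> (\<forall>a. \<forall>x\<in>I. a * x \<in> I)"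

definition maximal_left_ideal :: "'a::{ring, monoid_mult} set \<Rightarrow> bool" where
  "maximal_left_ideal M \<longleftrightarrow> left_ideal M \<and> M \<noteq> UNIV \<and>
     (\<forall>I. left_ideal I \<and> M \<subseteq> I \<longrightarrow> I = M \<or> I = UNIV)"

definition jacobson_radical :: "'a::{ring, monoid_mult} set" where
  "jacobson_radical = \<Inter> {M. maximal_left_ideal M}"

definition unital_subring :: "'a::{ring, monoid_mult} set \<Rightarrow> bool" where
  "unital_subring S \<longleftrightarrow> 1 \<in> S \<and> (\<forall>x\<in>S. \<forall>y\<in>S. x - y \<in> S \<and> x * y \<in> S)"

definition mult_on :: "'a::monoid_mult set \<Rightarrow> 'a monoid" where
  "mult_on S = \<lparr>carrier = S, monoid.mult = (*), one = 1\<rparr>"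

definition rat_additive_group :: "rat monoid" where
  "rat_additive_group = \<lparr>carrier = UNIV, monoid.mult = (+), one = 0\<rparr>"

context rat_algebra
begin

(* int.span is the additive subgroup (Z-submodule) generated by a set. *)

definition ideal_prod :: "'a set \<Rightarrow> 'a set \<Rightarrow> 'a set" where
  "ideal_prod I K = int.span {x * y | x y. x \<in> I \<and> y \<in> K}"

definition Z_order :: "'a set \<Rightarrow> bool" where
  "Z_order \<Gamma> \<longleftrightarrow> unital_subring \<Gamma> \<and> (\<exists>F. finite F \<and> \<Gamma> = int.span F) \<and> span \<Gamma> = UNIV"

(* The property does not depend on the order, so it may be required of some order or,
   equivalently, of every order. As a hypothesis the existential form is the weaker one
   on its face. *)
definition hyperbolic :: bool where
  "hyperbolic \<longleftrightarrow>
     (\<exists>\<Gamma>. Z_order \<Gamma> \<and>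
        mon (integer_group \<times>\<times> integer_group) (units_of (mult_on \<Gamma>)) = {})"

end

end

theory Submission
  imports Defs
begin

text \<open>
  Powers of an element \<open>x\<close> of \<open>J\<close> satisfy \<open>x ^ n = a * x ^ Suc n\<close> for some \<open>n\<close> and \<open>a\<close>, by finite
  dimension, and \<open>1 - a * x\<close> is left invertible; so \<open>x\<close> is nilpotent.
  If \<open>u\<close>, \<open>v\<close> are linearly independent with \<open>u * v = v * u = v * v = 0\<close> and \<open>u * u\<close> a multiple of \<open>v\<close>,
  then \<open>(a, b) \<mapsto> exp (a u + b v)\<close> is an injective homomorphism, which embeds
  \<open>\<int>\<^sup>2\<close> in the units of any order once \<open>u\<close>, \<open>v\<close> are replaced by suitable multiples.
  If \<open>x\<close> has nilpotency index \<open>n \<ge> 3\<close>, then \<open>x ^ (n - 2)\<close>, \<open>x ^ (n - 1)\<close> is such a pair, so in the hyperbolic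
  case every element of \<open>J\<close> squares to zero, and hence any two of them anticommute. For
  independent \<open>x, y\<close> in \<open>J\<close>, one of \<open>(x, y)\<close> and \<open>(x, x * y)\<close> would again be such a pair.
\<close>

section \<open>Left ideals\<close>

context rat_algebra
begin

text \<open>Multiplying by a scalar \<open>c\<close> is left multiplication by the element
  \<open>scale c 1\<close>.\<close>

lemma subspace_left_ideal:
  assumes "left_ideal I"
  shows "subspace I"
proof (rule subspaceI)
  show "0 \<in> I" using assms by (simp add: left_ideal_def)
  show "x + y \<in> I" if "x \<in> I" "y \<in> I" for x y
  proof -
    have "0 - y \<in> I" using assms that by (simp only: left_ideal_def)
    then have "x - (0 - y) \<in> I" using assms that by (simp only: left_ideal_def)
    then show ?thesis by simp
  qed
  show "scale c x \<in> I" if "x \<in> I" for c x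
  proof -
    have "scale c 1 * x \<in> I" using assms that by (simp add: left_ideal_def)
    then show ?thesis by (simp add: scale_mult_left)
  qed
qed

lemma left_ideal_range_mult:
  fixes x :: "'a"
  shows "left_ideal (range (\<lambda>a. a * x))"
  unfolding left_ideal_def
proof (intro conjI ballI allI)
  show "0 \<in> range (\<lambda>a. a * x)" by (rule range_eqI[of _ _ 0]) simp
next
  fix y z assume "y \<in> range (\<lambda>a. a * x)" "z \<in> range (\<lambda>a. a * x)"
  then obtain a b where "y = a * x" "z = b * x" by blast
  then have "y - z = (a - b) * x" by (simp add: left_diff_distrib)
  then show "y - z \<in> range (\<lambda>a. a * x)" by blast
next
  fix c y assume "y \<in> range (\<lambda>a. a * x)"
  then obtain a where "y = a * x" by blast
  then have "c * y = (c * a) * x" by (simp add: mult.assoc)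
  then show "c * y \<in> range (\<lambda>a. a * x)" by blast
qed

lemma left_ideal_jacobson_radical: "left_ideal (jacobson_radical :: 'a set)"
  by (simp add: jacobson_radical_def left_ideal_def maximal_left_ideal_def)

section \<open>Orders and clearing denominators\<close>

lemma Z_order_minus: "Z_order \<Gamma> \<Longrightarrow> x \<in> \<Gamma> \<Longrightarrow> y \<in> \<Gamma> \<Longrightarrow> x - y \<in> \<Gamma>"
  and Z_order_mult: "Z_order \<Gamma> \<Longrightarrow> x \<in> \<Gamma> \<Longrightarrow> y \<in> \<Gamma> \<Longrightarrow> x * y \<in> \<Gamma>"
  and Z_order_one: "Z_order \<Gamma> \<Longrightarrow> 1 \<in> \<Gamma>"
  by (auto simp: Z_order_def unital_subring_def)

lemma Z_order_subspace: "Z_order \<Gamma> \<Longrightarrow> int.subspace \<Gamma>"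
  unfolding Z_order_def using int.subspace_span by metis

text \<open>The elements with a positive integer multiple in \<open>\<Gamma>\<close> form a rational
  subspace containing \<open>\<Gamma>\<close>, and \<open>\<Gamma>\<close> spans the
  algebra.\<close>

lemma Z_order_multiple:
  assumes "Z_order \<Gamma>"
  obtains N :: int where "N > 0" "scale (of_int N) x \<in> \<Gamma>"
proof -
  note sub = Z_order_subspace[OF assms]
  let ?S = "{x. \<exists>N::int. N > 0 \<and> scale (of_int N) x \<in> \<Gamma>}"
  have "subspace ?S"
  proof (rule subspaceI)
    show "0 \<in> ?S" using int.subspace_0[OF sub] by (auto intro!: exI[of _ 1])
  next
    fix x y assume "x \<in> ?S" "y \<in> ?S"
    then obtain N M :: int where N: "N > 0" "scale (of_int N) x \<in> \<Gamma>"
      and M: "M > 0" "scale (of_int M) y \<in> \<Gamma>" by blast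
    have "scale (of_int M) (scale (of_int N) x) + scale (of_int N) (scale (of_int M) y) \<in> \<Gamma>"
      by (intro int.subspace_add[OF sub] int.subspace_scale[OF sub] N M)
    then have "scale (of_int (N * M)) (x + y) \<in> \<Gamma>"
      by (simp add: scale_right_distrib mult.commute)
    then show "x + y \<in> ?S" using N M by (auto intro!: exI[of _ "N * M"])
  next
    fix c :: rat and x assume "x \<in> ?S"
    then obtain N :: int where N: "N > 0" "scale (of_int N) x \<in> \<Gamma>" by blast
    obtain p q where "quotient_of c = (p, q)" by (cases "quotient_of c")
    then have pq: "q > 0" "c = of_int p / of_int q"
      by (rule quotient_of_denom_pos, rule quotient_of_div)
    have "scale (of_int p) (scale (of_int N) x) \<in> \<Gamma>"
      by (intro int.subspace_scale[OF sub] N)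
    moreover have "of_int p * of_int N = of_int (q * N) * c" using pq by simp
    ultimately have "scale (of_int (q * N)) (scale c x) \<in> \<Gamma>"
      by (simp only: scale_scale)
    then show "scale c x \<in> ?S" using N pq by (auto intro!: exI[of _ "q * N"])
  qed
  moreover have "\<Gamma> \<subseteq> ?S" by (auto intro!: exI[of _ 1])
  ultimately have "span \<Gamma> \<subseteq> ?S" by (rule span_minimal[rotated])
  then have "x \<in> ?S" using assms by (auto simp: Z_order_def)
  then show thesis using that by blast
qed

section \<open>Embedding \<int> \<times> \<int> by exponentials\<close>

lemma exp_pair_mult:
  assumes "u * v = 0" "v * u = 0" "v * v = 0" "u * u = scale c v"
  shows "(1 + scale a u + scale (b + c * a\<^sup>2 / 2) v) * (1 + scale a' u + scale (b' + c * a'\<^sup>2 / 2) v)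
       = 1 + scale (a + a') u + scale (b + b' + c * (a + a')\<^sup>2 / 2) v"
proof -
  have mult: "(1 + scale s u + scale t v) * (1 + scale s' u + scale t' v)
      = 1 + scale (s + s') u + scale (t + t' + s * s' * c) v" for s t s' t'
    by (simp add: distrib_left distrib_right scale_mult_left scale_mult_right assms
        scale_left_distrib scale_right_distrib add_ac mult_ac)
  \<comment> \<open>The term \<open>a * a' * c\<close>, produced by
    \<open>u * u = scale c v\<close>, is exactly the cross term of the square on the left.\<close>
  have "b + b' + c * (a + a')\<^sup>2 / 2 = (b + c * a\<^sup>2 / 2) + (b' + c * a'\<^sup>2 / 2) + a * a' * c"
    by (simp add: power2_eq_square field_simps)
  then show ?thesis by (simp only: mult)
qed

lemma hyperbolic_no_independent_pair:
  assumes hyp: hyperbolic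
    and prods: "u * v = 0" "v * u = 0" "v * v = 0" "u * u = scale c v"
  shows "\<exists>a b. scale a u + scale b v = 0 \<and> (a \<noteq> 0 \<or> b \<noteq> 0)"
proof (rule ccontr)
  assume "\<not> ?thesis"
  then have indep: "a = 0 \<and> b = 0" if "scale a u + scale b v = 0" for a b
    using that by blast
  obtain \<Gamma> where \<Gamma>: "Z_order \<Gamma>"
    and no: "mon (integer_group \<times>\<times> integer_group) (units_of (mult_on \<Gamma>)) = {}"
    using hyp by (auto simp: hyperbolic_def)
  note sub = Z_order_subspace[OF \<Gamma>]
  obtain N where N: "N > 0" "scale (of_int N) u \<in> \<Gamma>" using Z_order_multiple[OF \<Gamma>] .
  obtain M where M: "M > 0" "scale (of_int M) v \<in> \<Gamma>" using Z_order_multiple[OF \<Gamma>] .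
  \<comment> \<open>This is exp(a u + b v): the square of a u + b v is a^2 c v and its cube
    vanishes.\<close>
  define E where "E a b = 1 + scale a u + scale (b + c * a\<^sup>2 / 2) v" for a b
  \<comment> \<open>The factor 2 cancels the denominator in \<open>E\<close>: the quadratic term
    becomes 2 a^2 (N u)^2, which lies in \<open>\<Gamma>\<close> for every rational
    \<open>c\<close>.\<close>
  define f where "f = (\<lambda>(a::int, b::int). E (2 * of_int N * of_int a) (of_int M * of_int b))"
  have E_mult: "E a b * E a' b' = E (a + a') (b + b')" for a b a' b'
    unfolding E_def by (rule exp_pair_mult[OF prods])
  have f_mult: "f (a, b) * f (a', b') = f (a + a', b + b')" for a b a' b'
    by (simp add: f_def E_mult distrib_left)
  have f_0: "f (0, 0) = 1" by (simp add: f_def E_def)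
  have f_in: "f (a, b) \<in> \<Gamma>" for a b
  proof -
    let ?u = "scale (of_int N) u" and ?v = "scale (of_int M) v"
    have "1 + scale (of_int (2 * a)) ?u + scale (of_int b) ?v + scale (of_int (2 * a\<^sup>2)) (?u * ?u) \<in> \<Gamma>"
      by (intro int.subspace_add[OF sub] int.subspace_scale[OF sub] Z_order_mult[OF \<Gamma>]
          Z_order_one[OF \<Gamma>] N M)
    also have "1 + scale (of_int (2 * a)) ?u + scale (of_int b) ?v + scale (of_int (2 * a\<^sup>2)) (?u * ?u)
        = f (a, b)"
      by (simp add: f_def E_def scale_mult_left scale_mult_right prods scale_left_distrib
          power2_eq_square add_ac mult_ac)
    finally show ?thesis .
  qed
  have f_units: "f (a, b) \<in> Units (mult_on \<Gamma>)" for a b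
  proof -
    have "f (-a, -b) * f (a, b) = 1" "f (a, b) * f (-a, -b) = 1"
      by (simp_all add: f_mult f_0)
    then show ?thesis using f_in by (auto simp: Units_def mult_on_def)
  qed
  have f_inj: "a = a' \<and> b = b'" if "f (a, b) = f (a', b')" for a b a' b'
  proof -
    \<comment> \<open>These are the coordinates of \<open>f (a, b) - f (a', b')\<close> along
      \<open>u\<close> and \<open>v\<close>. Once \<open>p = 0\<close> gives \<open>a = a'\<close>,
      the quadratic terms in \<open>q\<close> cancel.\<close>
    define p q where "p = 2 * of_int N * of_int a - 2 * of_int N * (of_int a' :: rat)"
      and "q = (of_int M * of_int b + c * (2 * of_int N * of_int a)\<^sup>2 / 2)
        - (of_int M * of_int b' + c * (2 * of_int N * of_int a')\<^sup>2 / 2)"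
    have "scale p u + scale q v = f (a, b) - f (a', b')"
      unfolding p_def q_def f_def E_def by (simp only: scale_left_diff_distrib prod.case) simp
    then have "scale p u + scale q v = 0" using that by simp
    then have "p = 0" "q = 0" using indep by blast+
    then have "a = a'" using N by (simp add: p_def)
    with \<open>q = 0\<close> M show ?thesis by (simp add: q_def)
  qed
  have "f \<in> mon (integer_group \<times>\<times> integer_group) (units_of (mult_on \<Gamma>))"
    unfolding mon_def
  proof (intro CollectI conjI)
    show "f \<in> hom (integer_group \<times>\<times> integer_group) (units_of (mult_on \<Gamma>))"
      by (auto simp: hom_def units_of_def f_units f_mult)
        (simp add: mult_on_def f_mult)
    show "inj_on f (carrier (integer_group \<times>\<times> integer_group))"
      by (auto simp: inj_on_def dest: f_inj)
  qed
  then show False using no by blast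
qed

section \<open>Nilpotent elements in the hyperbolic case\<close>

lemma hyperbolic_nilpotent_square_zero:
  fixes x :: 'a
  assumes hyp: hyperbolic and "x ^ k = 0"
  shows "x * x = 0"
proof (rule ccontr)
  assume nz: "x * x \<noteq> 0"
  define n where "n = (LEAST n. x ^ n = 0)"
  have n: "x ^ n = 0" unfolding n_def by (rule LeastI) fact
  have small: "x ^ m \<noteq> 0" if "m < n" for m
    using that not_less_Least unfolding n_def by blast
  have large: "x ^ m = 0" if "m \<ge> n" for m
  proof -
    have "x ^ m = x ^ n * x ^ (m - n)" using that by (simp flip: power_add)
    then show ?thesis using n by simp
  qed
  have "n > 2"
    using nz large[of 2] by (simp add: power2_eq_square flip: not_le) blast
  then obtain m where m: "n = Suc (Suc (Suc m))"
    using less_imp_Suc_add[of 2 n] by auto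
  define u v where "u = x ^ Suc m" and "v = x ^ Suc (Suc m)"
  have "u * v = 0" "v * u = 0" "v * v = 0"
    unfolding u_def v_def power_add[symmetric] by (rule large, simp add: m)+
  moreover have "\<exists>c. u * u = scale c v"
  \<comment> \<open>For \<open>m = 0\<close> the index is 3, \<open>u\<close> is \<open>x\<close>
    and \<open>v\<close> is its square. Otherwise the exponent 2m + 2 of \<open>u * u\<close> is at
    least n = m + 3.\<close>
  proof (cases "m = 0")
    case True
    then have "u * u = scale 1 v" by (simp add: u_def v_def)
    then show ?thesis by blast
  next
    case False
    have "u * u = scale 0 v"
      unfolding u_def v_def power_add[symmetric] using False by (simp add: m large del: power_Suc)
    then show ?thesis by blast
  qed
  ultimately obtain a b where ab: "scale a u + scale b v = 0" "a \<noteq> 0 \<or> b \<noteq> 0"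
    using hyperbolic_no_independent_pair[OF hyp] by blast
  have v: "v \<noteq> 0" unfolding v_def by (rule small) (simp add: m)
  \<comment> \<open>Left multiplication by \<open>x\<close> sends \<open>u\<close> to
    \<open>v\<close> and kills \<open>v\<close>, which isolates the coefficient \<open>a\<close> of
    the relation.\<close>
  have "x * u = v" by (simp add: u_def v_def)
  moreover have "x * v = 0" using n by (simp add: v_def m)
  ultimately have "scale a v = x * (scale a u + scale b v)"
    by (simp add: distrib_left scale_mult_right)
  then have "a = 0" using ab v by simp
  with ab v show False by simp
qed

lemma hyperbolic_square_zero_dependent:
  assumes hyp: hyperbolic and sq: "x * x = 0" "y * y = 0" "(x + y) * (x + y) = 0"
    and x: "x \<noteq> 0"
  shows "y \<in> span {x}"
proof -
  \<comment> \<open>Expand the square of \<open>x + y\<close>.\<close>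
  have yx: "y * x = - (x * y)"
    using sq by (simp add: distrib_left distrib_right eq_neg_iff_add_eq_0 add.commute)
  let ?w = "x * y"
  have "x * ?w = 0" using sq by (simp flip: mult.assoc)
  moreover have "?w * x = 0"
    by (simp add: mult.assoc yx \<open>x * ?w = 0\<close>)
  moreover have "?w * ?w = 0"
    by (metis \<open>?w * x = 0\<close> mult.assoc mult_zero_left)
  moreover have "x * x = scale 0 ?w" using sq by simp
  ultimately obtain a b where ab: "scale a x + scale b ?w = 0" "a \<noteq> 0 \<or> b \<noteq> 0"
    using hyperbolic_no_independent_pair[OF hyp] by blast
  \<comment> \<open>Right multiplication by \<open>y\<close> kills \<open>?w\<close>. If
    \<open>?w\<close> were nonzero, this would give \<open>a = 0\<close>, and then the relation
    would give \<open>b = 0\<close>.\<close>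
  have "(scale a x + scale b ?w) * y = scale a ?w"
    using sq by (simp add: distrib_right scale_mult_left mult.assoc)
  then have "scale a ?w = 0" using ab by simp
  then have w: "?w = 0" using ab x by auto
  then have "y * x = 0" using yx by simp
  moreover have "x * x = scale 0 y" using sq by simp
  ultimately obtain a b where ab: "scale a x + scale b y = 0" "a \<noteq> 0 \<or> b \<noteq> 0"
    using hyperbolic_no_independent_pair[OF hyp w] sq by blast
  have b: "b \<noteq> 0" using ab x by auto
  have "scale b y = scale (- a) x" using ab by (simp add: add_eq_0_iff)
  then have "scale (1 / b) (scale b y) = scale (1 / b) (scale (- a) x)" by simp
  then have "y = scale (- a / b) x" using b by simp
  then show ?thesis unfolding span_singleton by (rule range_eqI)
qed

section \<open>The multiplicative group 1 + J\<close>

lemma mult_on_one_plus_span: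
  assumes "j * j = 0" "j \<noteq> 0"
  shows "group (mult_on ((+) 1 ` span {j}))"
    and "mult_on ((+) 1 ` span {j}) \<cong> rat_additive_group"
proof -
  let ?G = "mult_on ((+) 1 ` span {j})"
  \<comment> \<open>This is exp(q j), since \<open>j * j = 0\<close>; hence it turns sums into
    products.\<close>
  let ?e = "\<lambda>q. 1 + scale q j"
  have carr: "(+) 1 ` span {j} = range ?e" by (auto simp: span_singleton)
  have e_mult: "?e p * ?e q = ?e (p + q)" for p q
    using assms by (simp add: distrib_left distrib_right scale_mult_left scale_mult_right
        scale_left_distrib add_ac)
  have inj: "inj ?e" using assms by (auto simp: inj_def)
  have Q: "group rat_additive_group"
    by (rule groupI) (auto simp: rat_additive_group_def intro!: exI[of _ "- _"])
  have "?e \<in> iso rat_additive_group ?G"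
    by (auto simp: iso_def hom_def rat_additive_group_def mult_on_def carr e_mult bij_betw_def inj)
  then have iso: "rat_additive_group \<cong> ?G" by (auto simp: is_iso_def)
  show "group ?G"
  proof (rule groupI)
    show "\<one>\<^bsub>?G\<^esub> \<in> carrier ?G"
      unfolding mult_on_def carr by (auto intro!: range_eqI[of _ _ 0])
    show "\<exists>y\<in>carrier ?G. y \<otimes>\<^bsub>?G\<^esub> x = \<one>\<^bsub>?G\<^esub>" if "x \<in> carrier ?G" for x
    proof -
      obtain q where "x = ?e q" using \<open>x \<in> carrier ?G\<close> by (auto simp: mult_on_def carr)
      then have "?e (- q) * x = 1" by (simp only: e_mult) simp
      then show ?thesis unfolding mult_on_def carr monoid.simps partial_object.simps by blast
    qed
  qed (auto simp: mult_on_def carr mult.assoc e_mult)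
  show "?G \<cong> rat_additive_group" by (rule group.iso_sym[OF Q iso])
qed

end

section \<open>Dimension arguments and the Jacobson radical\<close>

context fin_dim_rat_algebra
begin

lemma exists_Basis: "\<exists>B. finite_dimensional_vector_space scale B"
proof -
  obtain C where C: "finite C" "span C = UNIV" using finite_dimensional by blast
  obtain B where "B \<subseteq> C" "independent B" "C \<subseteq> span B"
    using maximal_independent_subset[of C] by blast
  moreover from this have "span B = UNIV"
    using C span_minimal[OF _ subspace_span, of C B] by auto
  ultimately have "finite_dimensional_vector_space scale B"
    using C by unfold_locales (auto intro: finite_subset)
  then show ?thesis ..
qed

lemma dim_mono: "subspace S \<Longrightarrow> subspace T \<Longrightarrow> S \<subseteq> T \<Longrightarrow> dim S \<le> dim T"
  and subspace_eqI: "subspace S \<Longrightarrow> subspace T \<Longrightarrow> S \<subseteq> T \<Longrightarrow> dim T \<le> dim S \<Longrightarrow> S = T"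
proof -
  obtain B where "finite_dimensional_vector_space scale B" using exists_Basis by blast
  then interpret finite_dimensional_vector_space scale B .
  show "dim S \<le> dim T" if "S \<subseteq> T" using that by (rule dim_subset)
  show "S = T" if "subspace S" "subspace T" "S \<subseteq> T" "dim T \<le> dim S"
    using that by (rule subspace_dim_equal)
qed

text \<open>Among the proper left ideals containing \<open>I\<close>, one of greatest dimension is
  maximal.\<close>

lemma maximal_left_ideal_exists:
  fixes I :: "'a set"
  assumes "left_ideal I" "I \<noteq> UNIV"
  obtains M where "maximal_left_ideal M" "I \<subseteq> M"
proof -
  let ?P = "\<lambda>K. left_ideal K \<and> K \<noteq> UNIV \<and> I \<subseteq> K"
  have "?P I" using assms by simp
  moreover have "\<forall>K. ?P K \<longrightarrow> dim K < Suc (dim (UNIV :: 'a set))"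
    by (simp add: dim_mono subspace_left_ideal less_Suc_eq_le)
  ultimately have "\<exists>M. ?P M \<and> (\<forall>K. ?P K \<longrightarrow> dim K \<le> dim M)"
    by (rule ex_has_greatest_nat)
  then obtain M where M: "?P M" and max: "\<And>K. ?P K \<Longrightarrow> dim K \<le> dim M"
    by auto
  have "maximal_left_ideal M"
    unfolding maximal_left_ideal_def
  proof (intro conjI allI impI)
    fix K assume K: "left_ideal K \<and> M \<subseteq> K"
    show "K = M \<or> K = UNIV"
    proof (rule disjCI)
      assume "K \<noteq> UNIV"
      then have "dim K \<le> dim M" using K M by (intro max) auto
      then show "K = M" using K M subspace_eqI[of M K] subspace_left_ideal by blast
    qed
  qed (use M in auto)
  then show thesis using M that by blast
qed

text \<open>Otherwise the left ideal generated by \<open>1 - x\<close> lies in a maximal one, which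
  also contains \<open>x\<close> and therefore 1.\<close>

lemma jacobson_radical_left_invertible:
  fixes x :: "'a"
  assumes "x \<in> jacobson_radical"
  obtains y where "y * (1 - x) = 1"
proof -
  let ?L = "range (\<lambda>a. a * (1 - x))"
  have "?L = UNIV"
  proof (rule ccontr)
    assume "?L \<noteq> UNIV"
    then obtain M where M: "maximal_left_ideal M" "?L \<subseteq> M"
      using maximal_left_ideal_exists[OF left_ideal_range_mult] by blast
    have "1 * (1 - x) \<in> M" using M by blast
    moreover have "x \<in> M" using assms M by (auto simp: jacobson_radical_def)
    moreover have M': "left_ideal M" "M \<noteq> UNIV" using M by (auto simp: maximal_left_ideal_def)
    ultimately have "1 * (1 - x) + x \<in> M"
      by (intro subspace_add[OF subspace_left_ideal])
    then have "1 \<in> M" by simp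
    then have "a * 1 \<in> M" for a using M' unfolding left_ideal_def by blast
    then show False using M' by auto
  qed
  then have "1 \<in> ?L" by blast
  then show thesis using that by (metis imageE)
qed

text \<open>The left ideals generated by the powers of \<open>x\<close> descend, so the chain cannot
  drop after a term of least dimension.\<close>

lemma power_eq_mult_power_Suc:
  fixes x :: "'a"
  shows "\<exists>n a. x ^ n = a * x ^ Suc n"
proof -
  let ?S = "\<lambda>n. range (\<lambda>a. a * x ^ n)"
  obtain n where n: "\<And>m. dim (?S n) \<le> dim (?S m)"
    using ex_has_least_nat[of "\<lambda>_. True" 0 "\<lambda>n. dim (?S n)"] by auto
  have "?S (Suc n) \<subseteq> ?S n"
    by (auto simp: simp flip: mult.assoc)
  then have "?S (Suc n) = ?S n"
    by (rule subspace_eqI[OF subspace_left_ideal subspace_left_ideal,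
          OF left_ideal_range_mult left_ideal_range_mult _ n])
  moreover have "1 * x ^ n \<in> ?S n" by blast
  ultimately have "1 * x ^ n \<in> ?S (Suc n)" by simp
  then show ?thesis by auto
qed

lemma jacobson_radical_nilpotent:
  fixes x :: "'a"
  assumes "x \<in> jacobson_radical"
  shows "\<exists>n. x ^ n = 0"
proof -
  obtain n a where na: "x ^ n = a * x ^ Suc n" using power_eq_mult_power_Suc by blast
  have "a * x \<in> jacobson_radical"
    using assms left_ideal_jacobson_radical by (simp add: left_ideal_def)
  then obtain y where y: "y * (1 - a * x) = 1" by (rule jacobson_radical_left_invertible)
  have "(1 - a * x) * x ^ n = 0"
    using na by (simp add: left_diff_distrib mult.assoc)
  then have "y * (1 - a * x) * x ^ n = 0" by (simp add: mult.assoc)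
  then show ?thesis using y by auto
qed

lemma hyperbolic_jacobson_radical_span:
  assumes hyp: hyperbolic
  obtains j where "j * j = 0" "jacobson_radical = span {j}"
proof -
  let ?J = "jacobson_radical :: 'a set"
  have sub: "subspace ?J" by (rule subspace_left_ideal[OF left_ideal_jacobson_radical])
  have sq: "x * x = 0" if "x \<in> ?J" for x
    using jacobson_radical_nilpotent[OF that] hyperbolic_nilpotent_square_zero[OF hyp] by blast
  show thesis
  proof (cases "?J = {0}")
    \<comment> \<open>The witness 0 lets a single \<open>span\<close> statement cover the zero
      radical too.\<close>
    case True
    moreover have "span {0 :: 'a} = {0}" by (auto simp: span_singleton)
    ultimately have "?J = span {0}" by (rule trans[OF _ sym])
    with that[of 0] show ?thesis by (metis mult_zero_left)
  next
    case False
    then obtain j where j: "j \<in> ?J" "j \<noteq> 0" using subspace_0[OF sub] by blast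
    \<comment> \<open>As \<open>?J\<close> is closed under sums, \<open>j + y\<close> squares to
      zero for each \<open>y\<close> in \<open>?J\<close>, which is what forces dependence on
      \<open>j\<close>.\<close>
    have "?J \<subseteq> span {j}"
      using j sq subspace_add[OF sub] hyperbolic_square_zero_dependent[OF hyp] by blast
    moreover have "span {j} \<subseteq> ?J" using j sub by (intro span_minimal) auto
    ultimately show ?thesis using that[of j] sq j by blast
  qed
qed

end

theorem lemma3p2:
  fixes scale :: "rat \<Rightarrow> 'a::{ring, monoid_mult} \<Rightarrow> 'a"
    and J :: "'a set"
  assumes "fin_dim_rat_algebra scale"
    and "rat_algebra.hyperbolic scale"
    and "J = jacobson_radical"
  shows "rat_algebra.ideal_prod scale J J = {0} \<and>
         vector_space.dim scale J \<le> 1 \<and>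
         (J \<noteq> {0} \<longrightarrow>
            (\<exists>j\<^sub>0. j\<^sub>0 ^ 2 = 0 \<and> J = module.span scale {j\<^sub>0} \<and>
               group (mult_on ((+) 1 ` J)) \<and>
               mult_on ((+) 1 ` J) \<cong> rat_additive_group))"
proof -
  interpret fin_dim_rat_algebra scale by fact
  obtain j where j: "j * j = 0" and J: "J = span {j}"
    using hyperbolic_jacobson_radical_span assms by metis
  have "{x * y | x y. x \<in> J \<and> y \<in> J} \<subseteq> {0}"
    using j by (auto simp: J span_singleton scale_mult_left scale_mult_right)
  then have "ideal_prod J J \<subseteq> {0}"
    unfolding ideal_prod_def by (rule int.span_minimal) (rule int.subspace_single_0)
  then have "ideal_prod J J = {0}"
    using int.span_zero unfolding ideal_prod_def by blast
  moreover have "dim J \<le> 1"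
    \<comment> \<open>Bounding by the size of a spanning set includes the case
      \<open>j = 0\<close>.\<close>
    using dim_le_card[of J "{j}"] by (simp add: J)
  moreover have "j \<noteq> 0" if "J \<noteq> {0}" using that by (auto simp: J)
  ultimately show ?thesis
    using j mult_on_one_plus_span[OF j] by (auto simp: J power2_eq_square)
qed

end
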